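(* Let $\mathcal{A} \subset \mathbb{Z}$ be a finite alphabet and let $\eta \in \mathcal{A}^{\mathbb{Z}^2}$ be a low convex complexity configuration. Suppose that $\eta$ has a $\mathbb{Z}$-minimal periodic decomposition $\eta = \eta_1+\eta_2+\eta_3$ with three terms. Then: (i) (Szabados's conjecture holds for $\eta$) if $\eta$ is not fully periodic, then for every $\mathbb{Z}$-minimal periodic decomposition $\eta = \vartheta_1+\cdots+\vartheta_m$ and every line $\ell \subset \mathbb{R}^2$ through the origin, $\ell$ contains a period of $\vartheta_i$ for some $1 \le i \le m$ if and only if $\ell \in \mathrm{NEL}(\eta)$; (ii) for every line $\ell \subset \mathbb{R}^2$ through the origin, $\ell \in \mathrm{NEL}(\eta)$ if and only if both oriented lines $\pmb{\ell}, -\pmb{\ell}$ belong to $\mathrm{ONED}(\eta)$.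
   Context: The alphabet $\mathcal{A}$ is finite with at least two elements. A configuration is an element $\eta = (\eta_g)_{g\in\mathbb{Z}^2} \in \mathcal{A}^{\mathbb{Z}^2}$; for $u \in \mathbb{Z}^2$, $(T^u\eta)_g = \eta_{g+u}$. A non-zero $h \in \mathbb{Z}^2$ is a period of $\eta$ if $\eta_{g+h}=\eta_g$ for all $g$; $\eta$ is periodic if it has a period and fully periodic if it has two periods linearly independent over $\mathbb{R}$. The same terminology is used for elements of $\mathbb{Z}^{\mathbb{Z}^2}$ (possibly taking infinitely many values). For a non-empty finite $\mathcal{S} \subset \mathbb{Z}^2$, $P_\eta(\mathcal{S})$ is the number of distinct patterns $(T^u\eta)|_{\mathcal{S}}$, $u \in \mathbb{Z}^2$. A set $\mathcal{S} \subset \mathbb{Z}^2$ is convex if its convex hull $\mathrm{Conv}(\mathcal{S})$ in $\mathbb{R}^2$ is closed and $\mathcal{S} = \mathrm{Conv}(\mathcal{S}) \cap \mathbb{Z}^2$. $\eta$ has low convex complexity if $P_\eta(\mathcal{S}) \le |\mathcal{S}|$ for some non-empty, finite, convex $\mathcal{S} \subset \mathbb{Z}^2$. A $\mathbb{Z}$-periodic decomposition of a configuration $\vartheta$ with integer values is an expression $\vartheta = \vartheta_1+\cdots+\vartheta_m$ (pointwise sum) with each $\vartheta_i \in \mathbb{Z}^{\mathbb{Z}^2}$ periodic (possibly with infinitely many values). It is $\mathbb{Z}$-minimal if $m \le n$ for every $\mathbb{Z}$-periodic decomposition of $\vartheta$ with $n$ terms. $X_\eta = \overline{\{T^u\eta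 : u \in \mathbb{Z}^2\}}$ (closure in the product topology). A line $\ell$ through the origin is expansive on $X_\eta$ if there is $t>0$ such that, with $\ell^t = \{g \in \mathbb{Z}^2 : \mathrm{dist}(g,\ell) \le t\}$ (Euclidean distance), for all $x,y\in X_\eta$, $x|_{\ell^t} = y|_{\ell^t}$ implies $x=y$; otherwise it is nonexpansive. $\mathrm{NEL}(\eta)$ is the set of lines through the origin that are nonexpansive on $X_\eta$. For an oriented line $\pmb{\ell}$ through the origin with orientation vector $(u_1,u_2)\neq 0$, $\mathcal{H}(\pmb{\ell}) = \{g \in \mathbb{Z}^2 : \langle g,(-u_2,u_1)\rangle \ge 0\}$. $\pmb{\ell}$ is a one-sided expansive direction on $X_\eta$ if for all $x,y\in X_\eta$, $x|_{\mathcal{H}(\pmb{\ell})} = y|_{\mathcal{H}(\pmb{\ell})}$ implies $x=y$; otherwise it is one-sided nonexpansive. $\mathrm{ONED}(\eta)$ is the set of oriented lines through the origin that are one-sided nonexpansive directions on $X_\eta$. For a line $\ell$, $\pmb{\ell}$ is $\ell$ with a given orientation and $-\pmb{\ell}$ is $\ell$ with the opposite orientation. *)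

theory Defs
  imports "HOL-Analysis.Analysis"
begin

type_synonym point = "int \<times> int"
type_synonym 'a config = "point \<Rightarrow> 'a"

definition emb :: "point \<Rightarrow> real \<times> real" where
  "emb g = (of_int (fst g), of_int (snd g))"

definition shift :: "point \<Rightarrow> 'a config \<Rightarrow> 'a config" where
  "shift u \<eta> = (\<lambda>g. \<eta> (g + u))"

definition is_period :: "'a config \<Rightarrow> point \<Rightarrow> bool" where
  "is_period \<eta> h \<longleftrightarrow> h \<noteq> 0 \<and> (\<forall>g. \<eta> (g + h) = \<eta> g)"

definition periodic :: "'a config \<Rightarrow> bool" where
  "periodic \<eta> \<longleftrightarrow> (\<exists>h. is_period \<eta> h)"

text \<open>The condition \<open>h \<noteq> k\<close> is needed because \<open>independent\<close> refers to the set
  \<open>{emb h, emb k}\<close>, which collapses to a singleton when \<open>h = k\<close>.\<close>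

definition fully_periodic :: "'a config \<Rightarrow> bool" where
  "fully_periodic \<eta> \<longleftrightarrow>
     (\<exists>h k. is_period \<eta> h \<and> is_period \<eta> k \<and> h \<noteq> k \<and> independent {emb h, emb k})"

definition pattern_complexity :: "'a config \<Rightarrow> point set \<Rightarrow> nat" where
  "pattern_complexity \<eta> S = card (range (\<lambda>u. restrict (shift u \<eta>) S))"

definition lattice_convex :: "point set \<Rightarrow> bool" where
  "lattice_convex S \<longleftrightarrow>
     closed (convex hull (emb ` S)) \<and> S = {g. emb g \<in> convex hull (emb ` S)}"

text \<open>For a configuration with infinitely many values \<open>card\<close> may be taken of an infinite set
  of patterns; the notion is meant for configurations over a finite alphabet only.\<close>

definition low_convex_complexity :: "'a config \<Rightarrow> bool" where
  "low_convex_complexity \<eta> \<longleftrightarrow>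
     (\<exists>S. S \<noteq> {} \<and> finite S \<and> lattice_convex S \<and> pattern_complexity \<eta> S \<le> card S)"

definition Z_periodic_decomposition :: "int config \<Rightarrow> nat \<Rightarrow> (nat \<Rightarrow> int config) \<Rightarrow> bool" where
  "Z_periodic_decomposition \<theta> m f \<longleftrightarrow>
     m \<ge> 1 \<and> (\<forall>i\<in>{1..m}. periodic (f i)) \<and> (\<forall>g. \<theta> g = (\<Sum>i=1..m. f i g))"

definition Z_minimal_decomposition :: "int config \<Rightarrow> nat \<Rightarrow> (nat \<Rightarrow> int config) \<Rightarrow> bool" where
  "Z_minimal_decomposition \<theta> m f \<longleftrightarrow>
     Z_periodic_decomposition \<theta> m f \<and>
     (\<forall>n f'. Z_periodic_decomposition \<theta> n f' \<longrightarrow> m \<le> n)"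

text \<open>The closure is taken in the product topology of the function space; the standard topology
  on \<open>int\<close> is discrete.  If \<open>\<eta>\<close> takes values in a finite alphabet \<open>A\<close>, so does every element
  of the closure.\<close>

definition orbit_closure :: "int config \<Rightarrow> int config set" where
  "orbit_closure \<eta> = closure (range (\<lambda>u. shift u \<eta>))"

definition lines_through_origin :: "(real \<times> real) set set" where
  "lines_through_origin = {span {v} |v. v \<noteq> 0}"

definition strip :: "(real \<times> real) set \<Rightarrow> real \<Rightarrow> point set" where
  "strip l t = {g. infdist (emb g) l \<le> t}"

definition expansive :: "'a config set \<Rightarrow> (real \<times> real) set \<Rightarrow> bool" where
  "expansive X l \<longleftrightarrow>
     (\<exists>t>0. \<forall>x\<in>X. \<forall>y\<in>X. (\<forall>g\<in>strip l t. x g = y g) \<longrightarrow> x = y)"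

definition NEL :: "int config \<Rightarrow> (real \<times> real) set set" where
  "NEL \<eta> = {l \<in> lines_through_origin. \<not> expansive (orbit_closure \<eta>) l}"

text \<open>An oriented line through the origin is represented by the set of all its orientation
  vectors, i.e. by the open ray spanned by any one of them.\<close>

definition oriented_line :: "real \<times> real \<Rightarrow> (real \<times> real) set" where
  "oriented_line u = {c *\<^sub>R u |c. c > 0}"

definition half_plane :: "real \<times> real \<Rightarrow> point set" where
  "half_plane u = {g. emb g \<bullet> (- snd u, fst u) \<ge> 0}"

definition one_sided_expansive :: "'a config set \<Rightarrow> real \<times> real \<Rightarrow> bool" where
  "one_sided_expansive X u \<longleftrightarrow>
     (\<forall>x\<in>X. \<forall>y\<in>X. (\<forall>g\<in>half_plane u. x g = y g) \<longrightarrow> x = y)"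

definition ONED :: "int config \<Rightarrow> (real \<times> real) set set" where
  "ONED \<eta> = {oriented_line u |u. u \<noteq> 0 \<and> \<not> one_sided_expansive (orbit_closure \<eta>) u}"

text \<open>The half plane, and hence one-sided expansiveness, depends only on the oriented line and
  not on the chosen orientation vector.\<close>

lemma half_plane_scaleR: "c > 0 \<Longrightarrow> half_plane (c *\<^sub>R u) = half_plane u"
proof -
  assume c: "c > 0"
  have "emb g \<bullet> (- snd (c *\<^sub>R u), fst (c *\<^sub>R u)) = c * (emb g \<bullet> (- snd u, fst u))" for g
    by (simp add: inner_prod_def algebra_simps)
  then show ?thesis
    using c by (simp add: half_plane_def zero_le_mult_iff)
qed

lemma oriented_line_in_ONED_iff:
  assumes "u \<noteq> 0"
  shows "oriented_line u \<in> ONED \<eta> \<longleftrightarrow> \<not> one_sided_expansive (orbit_closure \<eta>) u"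
proof -
  have same: "one_sided_expansive X v = one_sided_expansive X u"
    if eq: "oriented_line u = oriented_line v" for v and X :: "int config set"
  proof -
    have "u = 1 *\<^sub>R u" "(1::real) > 0" by simp_all
    then have "u \<in> oriented_line u" unfolding oriented_line_def by blast
    then have "u \<in> oriented_line v" unfolding eq .
    then obtain c where "c > 0" "u = c *\<^sub>R v" unfolding oriented_line_def by blast
    then have "half_plane u = half_plane v" by (metis half_plane_scaleR)
    then show ?thesis by (simp only: one_sided_expansive_def)
  qed
  show ?thesis
  proof
    assume "oriented_line u \<in> ONED \<eta>"
    then obtain v where "oriented_line u = oriented_line v"
      "\<not> one_sided_expansive (orbit_closure \<eta>) v"
      unfolding ONED_def by blast
    then show "\<not> one_sided_expansive (orbit_closure \<eta>) u" using same by blast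
  next
    assume "\<not> one_sided_expansive (orbit_closure \<eta>) u"
    then show "oriented_line u \<in> ONED \<eta>" unfolding ONED_def using assms by blast
  qed
qed

end

theory Submission
  imports Defs
begin

text \<open>
  Write \<open>\<eta> = a + b + c\<close> with periods \<open>p\<close>, \<open>q\<close>, \<open>r\<close>. By minimality no two of these are parallel,
  and \<open>\<eta>\<close> is not a sum of two periodic configurations. Both parts of the theorem follow once
  it is known that the nonexpansive lines are exactly the three lines spanned by such
  periods, and that along each of them both orientations are one-sided nonexpansive.

  A line \<open>l\<close> that contains none of the periods is expansive. The product of the three
  difference operators in the directions \<open>p\<close>, \<open>q\<close>, \<open>r\<close> annihilates \<open>\<eta>\<close>, hence every point of
  the orbit closure. The linear recurrence so obtained has, on either side of \<open>l\<close>, a single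
  extreme term, with coefficient \<open>\<plusminus>1\<close>; so the values on a wide enough strip around \<open>l\<close>
  determine all others (\<open>expansive_transverse_to_periods\<close>). Conversely a one-sided
  nonexpansive direction spans a nonexpansive line, because a half plane contains translates
  of every strip (\<open>expansive_imp_one_sided_expansive\<close>).

  The heart is \<open>nonexpansive_along_period\<close>. Suppose that the half plane \<open>H\<close> bounded by the
  line through \<open>p\<close> determined everything. By compactness a finite window \<open>Q \<subseteq> H\<close> determines a
  fundamental piece of the layer just below \<open>H\<close>. The alphabet is finite, so among boundedly
  many translates of \<open>\<eta>\<close> by multiples of \<open>q\<close> two agree on \<open>Q\<close>; let \<open>d\<close> be their difference. The
  term \<open>b\<close> cancels in \<open>d\<close>, and the difference of \<open>d\<close> along \<open>r\<close> also kills \<open>c\<close>, leaving an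
  expression in \<open>a\<close> only, which is \<open>p\<close>-periodic. So \<open>d\<close> is known to be constant along \<open>r\<close> on a
  whole layer as soon as this is known for representatives modulo \<open>p\<close>. Thus one can
  walk downwards along \<open>r\<close>: determinism gives \<open>d = 0\<close> on the new piece of the layer,
  periodicity spreads this to the flatness of \<open>d\<close> along \<open>r\<close>, and flatness carries the window
  \<open>Q\<close>, on which \<open>d\<close> vanishes, one step down (\<open>difference_vanishes_below\<close>). In this way the
  difference of \<open>\<eta>\<close> along \<open>r\<close> is invariant under some \<open>k q\<close> on a lower half plane, with \<open>k\<close> bounded by
  a constant \<open>K\<close> that does not depend on how high that half plane reaches. Hence it is
  invariant under \<open>K! q\<close> everywhere, so that \<open>\<eta>\<close> is a sum of a \<open>K! q\<close>-periodic and an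
  \<open>r\<close>-periodic configuration, contrary to minimality.
\<close>

section \<open>Orbit closures and compactness\<close>

(* Lattice points are kept as single variables rather than as pairs of coordinates. *)
declare split_paired_All [simp del] split_paired_Ex [simp del]

text \<open>The basic neighbourhoods of the product topology prescribe finitely many coordinates, and
  the value space is discrete; all later uses of the closure go through this description.\<close>

lemma orbit_closure_iff:
  "x \<in> orbit_closure \<eta> \<longleftrightarrow> (\<forall>F. finite F \<longrightarrow> (\<exists>u. \<forall>g\<in>F. x g = \<eta> (g + u)))"
proof
  assume x: "x \<in> orbit_closure \<eta>"
  show "\<forall>F. finite F \<longrightarrow> (\<exists>u. \<forall>g\<in>F. x g = \<eta> (g + u))"
  proof (intro allI impI)
    fix F :: "point set" assume F: "finite F"
    let ?T = "\<Inter>g\<in>F. (\<lambda>y. y g) -` {x g}"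
    have "open ((\<lambda>y :: int config. y g) -` {x g})" for g
      by (rule open_vimage) (auto intro: open_discrete continuous_on_product_coordinates)
    then have "open ?T" using F by auto
    moreover have "x \<in> ?T" by simp
    ultimately have "range (\<lambda>u. shift u \<eta>) \<inter> ?T \<noteq> {}"
      using x unfolding orbit_closure_def closure_iff_nhds_not_empty by blast
    then show "\<exists>u. \<forall>g\<in>F. x g = \<eta> (g + u)" by (auto simp: shift_def) metis
  qed
next
  assume *: "\<forall>F. finite F \<longrightarrow> (\<exists>u. \<forall>g\<in>F. x g = \<eta> (g + u))"
  show "x \<in> orbit_closure \<eta>"
    unfolding orbit_closure_def closure_iff_nhds_not_empty
  proof (intro allI impI)
    fix B S :: "int config set" assume BS: "S \<subseteq> B" "open S" "x \<in> S"
    then obtain X where X: "x \<in> Pi\<^sub>E UNIV X" "finite {i. X i \<noteq> UNIV}" "Pi\<^sub>E UNIV X \<subseteq> S"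
      using product_topology_open_contains_basis[of "\<lambda>_. euclidean" UNIV S x]
      by (auto simp: open_fun_def)
    obtain u where u: "\<forall>g\<in>{i. X i \<noteq> UNIV}. x g = \<eta> (g + u)" using * X(2) by blast
    have "shift u \<eta> \<in> Pi\<^sub>E UNIV X"
    proof -
      have "shift u \<eta> i \<in> X i" for i
      proof (cases "X i = UNIV")
        case False
        then have "shift u \<eta> i = x i" using u by (simp add: shift_def)
        then show ?thesis using X(1) by auto
      qed simp
      then show ?thesis by auto
    qed
    then show "range (\<lambda>u. shift u \<eta>) \<inter> B \<noteq> {}" using X(3) BS by blast
  qed
qed

lemma shift_in_orbit_closure: "shift u \<eta> \<in> orbit_closure \<eta>"
  unfolding orbit_closure_def by (rule subsetD[OF closure_subset]) simp

lemma orbit_closure_shift: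
  assumes "x \<in> orbit_closure \<eta>" shows "shift v x \<in> orbit_closure \<eta>"
  unfolding orbit_closure_iff
proof (intro allI impI)
  fix F :: "point set" assume "finite F"
  then have "finite ((\<lambda>g. g + v) ` F)" by simp
  then obtain u where "\<forall>g\<in>(\<lambda>g. g + v) ` F. x g = \<eta> (g + u)"
    using assms unfolding orbit_closure_iff by blast
  then show "\<exists>u. \<forall>g\<in>F. shift v x g = \<eta> (g + u)"
    by (intro exI[of _ "v + u"]) (auto simp: shift_def add.assoc)
qed

lemma compact_orbit_closure:
  assumes "finite A" and "range \<eta> \<subseteq> A"
  shows "compact (orbit_closure \<eta>)"
proof -
  have "compactin (product_topology (\<lambda>_. euclidean) UNIV) (Pi\<^sub>E UNIV (\<lambda>_ :: point. A))"
    using assms by (intro compactin_PiE[THEN iffD2]) (auto simp: finite_imp_compact)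
  then have "compact (Pi\<^sub>E UNIV (\<lambda>_ :: point. A))"
    by (simp add: euclidean_product_topology)
  moreover have "orbit_closure \<eta> \<subseteq> Pi\<^sub>E UNIV (\<lambda>_. A)"
  proof
    fix x assume x: "x \<in> orbit_closure \<eta>"
    have "x g \<in> A" for g
    proof -
      obtain u where "\<forall>k\<in>{g}. x k = \<eta> (k + u)" using x unfolding orbit_closure_iff by blast
      then show ?thesis using assms by auto
    qed
    then show "x \<in> Pi\<^sub>E UNIV (\<lambda>_. A)" by auto
  qed
  ultimately show ?thesis
    unfolding orbit_closure_def by (metis closed_closure compact_Int_closed inf.absorb_iff2)
qed

text \<open>Compactness turns determinism from an infinite half plane into determinism from a finite
  window: the pairs of points that differ somewhere on \<open>R\<close> form a compact set, and a
  failure for each finite window would by the finite intersection property give two points that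
  agree on all of the half plane and differ on \<open>R\<close>.\<close>

lemma one_sided_expansive_finite_window:
  assumes cpt: "compact X" and exp: "one_sided_expansive X u" and R: "finite R"
  shows "\<exists>F. finite F \<and> F \<subseteq> half_plane u \<and>
           (\<forall>x\<in>X. \<forall>y\<in>X. (\<forall>g\<in>F. x g = y g) \<longrightarrow> (\<forall>g\<in>R. x g = (y g :: int)))"
    (is ?goal)
proof (rule ccontr)
  assume contra: "\<not> ?goal"
  let ?E = "\<lambda>g. {p :: int config \<times> int config. fst p g = snd p g}"
  let ?K = "(X \<times> X) \<inter> (\<Union>g\<in>R. - ?E g)"
  have op: "open ((\<lambda>p :: int config \<times> int config. fst p g) -` N)"
    "open ((\<lambda>p :: int config \<times> int config. snd p g) -` N)" for g N
  proof -
    have "continuous_on UNIV (\<lambda>p :: int config \<times> int config. fst p g)"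
      by (rule continuous_on_compose2[OF continuous_on_product_coordinates[of g]
            continuous_on_fst[OF continuous_on_id]]) simp
    then show "open ((\<lambda>p :: int config \<times> int config. fst p g) -` N)"
      by (rule open_vimage[OF open_discrete])
    have "continuous_on UNIV (\<lambda>p :: int config \<times> int config. snd p g)"
      by (rule continuous_on_compose2[OF continuous_on_product_coordinates[of g]
            continuous_on_snd[OF continuous_on_id]]) simp
    then show "open ((\<lambda>p :: int config \<times> int config. snd p g) -` N)"
      by (rule open_vimage[OF open_discrete])
  qed
  have cl: "closed (?E g)" "closed (- ?E g)" for g
  proof -
    have ne: "- ?E g = (\<Union>n. (\<lambda>p. fst p g) -` {n} \<inter> (\<lambda>p. snd p g) -` (- {n}))"
      by auto
    show "closed (?E g)"
      unfolding closed_def ne by (intro open_UN ballI open_Int op)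
    have eq: "?E g = (\<Union>n. (\<lambda>p. fst p g) -` {n} \<inter> (\<lambda>p. snd p g) -` {n})"
      by auto
    show "closed (- ?E g)"
      unfolding closed_def double_complement eq by (intro open_UN ballI open_Int op)
  qed
  have "closed (\<Union>g\<in>R. - ?E g)" by (rule closed_UN[OF R]) (rule ballI, rule cl)
  then have cptK: "compact ?K" by (rule compact_Int_closed[OF compact_Times[OF cpt cpt]])
  have fip: "?K \<inter> (\<Inter>g\<in>F. ?E g) \<noteq> {}" if F: "finite F" "F \<subseteq> half_plane u" for F
  proof -
    have "\<not> (\<forall>x\<in>X. \<forall>y\<in>X. (\<forall>g\<in>F. x g = y g) \<longrightarrow> (\<forall>g\<in>R. x g = y g))"
    proof
      assume "\<forall>x\<in>X. \<forall>y\<in>X. (\<forall>g\<in>F. x g = y g) \<longrightarrow> (\<forall>g\<in>R. x g = y g)"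
      then have ?goal using F by (intro exI[of _ F] conjI)
      then show False using contra by (rule notE[rotated])
    qed
    then obtain x y where "x \<in> X" "y \<in> X" "\<forall>g\<in>F. x g = y g" "\<not> (\<forall>g\<in>R. x g = y g)"
      by blast
    then have "(x, y) \<in> ?K \<inter> (\<Inter>g\<in>F. ?E g)" by auto
    then show ?thesis by blast
  qed
  have "?K \<inter> (\<Inter>g\<in>half_plane u. ?E g) \<noteq> {}"
    by (rule compact_imp_fip_image[OF cptK]) (rule cl, rule fip)
  then obtain w where w: "w \<in> ?K \<inter> (\<Inter>g\<in>half_plane u. ?E g)"
    unfolding ex_in_conv[symmetric] by (rule exE)
  have wX: "fst w \<in> X" "snd w \<in> X" using w by (simp_all add: mem_Times_iff)
  have agree: "\<forall>g\<in>half_plane u. fst w g = snd w g" using w by simp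
  have ne: "\<exists>g\<in>R. fst w g \<noteq> snd w g" using w by simp
  have "fst w = snd w"
    using exp wX agree unfolding one_sided_expansive_def by blast
  then show False using ne by simp
qed

section \<open>Periods and difference operators\<close>

text \<open>The determinant of two vectors. For fixed \<open>p\<close> the functional \<open>cross p\<close> measures the height
  above the line through \<open>p\<close>; it takes integer values.\<close>

definition cross :: "point \<Rightarrow> point \<Rightarrow> int" where
  "cross p q = fst p * snd q - snd p * fst q"

definition zmul :: "int \<Rightarrow> point \<Rightarrow> point" where
  "zmul n p = (n * fst p, n * snd p)"

definition diff :: "point \<Rightarrow> int config \<Rightarrow> int config" where
  "diff h x = (\<lambda>g. x (g + h) - x g)"

lemma zmul_simps [simp]: "zmul 0 p = 0" "zmul 1 p = p" "zmul (-1) p = - p"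
  by (simp_all add: zmul_def prod_eq_iff)

lemma zmul_add: "zmul (m + n) p = zmul m p + zmul n p"
  by (simp add: zmul_def prod_eq_iff algebra_simps)

lemma zmul_diff: "zmul (m - n) p = zmul m p - zmul n p"
  by (simp add: zmul_def prod_eq_iff algebra_simps)

lemma cross_simps [simp]:
  "cross p (q + r) = cross p q + cross p r" "cross (p + q) r = cross p r + cross q r"
  "cross p (q - r) = cross p q - cross p r" "cross (p - q) r = cross p r - cross q r"
  "cross p (- q) = - cross p q" "cross (- p) q = - cross p q"
  "cross p (zmul n q) = n * cross p q" "cross (zmul n p) q = n * cross p q"
  "cross p p = 0" "cross p 0 = 0" "cross 0 p = 0"
  by (simp_all add: cross_def zmul_def algebra_simps)

lemma diff_commute: "diff p (diff q x) = diff q (diff p x)"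
  by (simp add: diff_def algebra_simps)

lemma diff_add: "diff p (\<lambda>g. x g + y g) = (\<lambda>g. diff p x g + diff p y g)"
  by (simp add: diff_def fun_eq_iff)

lemma diff_zero [simp]: "diff p (\<lambda>g. 0) = (\<lambda>g. 0)"
  by (simp add: diff_def)

lemma is_period_diff: "is_period x h \<Longrightarrow> diff h x = (\<lambda>g. 0)"
  by (simp add: is_period_def diff_def)

lemma invariant_zmul:
  assumes "\<And>g. x (g + h) = x g" shows "x (g + zmul n h) = x g"
proof (induction n rule: int_induct[where k = 0])
  case (step1 i)
  have "x (g + zmul (i + 1) h) = x (g + zmul i h)"
    using assms[of "g + zmul i h"] by (simp add: zmul_add add.assoc)
  then show ?case using step1 by simp
next
  case (step2 i)
  have "x (g + zmul (i - 1) h) = x (g + zmul i h)"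
    using assms[of "g + zmul (i - 1) h"] by (simp add: zmul_diff)
  then show ?case using step2 by simp
qed simp

lemma is_period_zmul:
  assumes "is_period x h" and "n \<noteq> 0" shows "is_period x (zmul n h)"
proof -
  have "zmul n h \<noteq> 0" using assms by (auto simp: is_period_def zmul_def prod_eq_iff)
  then show ?thesis using assms invariant_zmul[of x h] by (auto simp: is_period_def)
qed

lemma is_period_minus: "is_period x h \<Longrightarrow> is_period x (- h)"
  using is_period_zmul[of x h "-1"] by simp

lemma parallel_common_multiple:
  assumes "cross p q = 0" "p \<noteq> 0" "q \<noteq> 0"
  obtains m n where "m \<noteq> 0" "n \<noteq> 0" "zmul m p = zmul n q"
proof (cases "fst p = 0")
  case True
  then have "snd p \<noteq> 0" "fst q = 0" using assms by (auto simp: cross_def prod_eq_iff)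
  then have "snd q \<noteq> 0" using assms by (auto simp: prod_eq_iff)
  then show ?thesis using \<open>snd p \<noteq> 0\<close> \<open>fst q = 0\<close> True
    by (intro that[of "snd q" "snd p"]) (auto simp: zmul_def)
next
  case False
  then have "fst q \<noteq> 0" using assms by (auto simp: cross_def prod_eq_iff)
  then show ?thesis using False assms
    by (intro that[of "fst q" "fst p"]) (auto simp: zmul_def cross_def)
qed

lemma parallel_periods_sum:
  assumes "is_period x p" "is_period y q" "cross p q = 0"
  shows "periodic (\<lambda>g. x g + y g :: int)"
proof -
  obtain m n where mn: "m \<noteq> 0" "n \<noteq> 0" "zmul m p = zmul n q"
    using parallel_common_multiple[of p q] assms by (auto simp: is_period_def)
  have "is_period x (zmul m p)" "is_period y (zmul m p)"
    using is_period_zmul[OF assms(1) mn(1)] is_period_zmul[OF assms(2) mn(2)] mn(3) by auto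
  then show ?thesis unfolding periodic_def is_period_def by (intro exI[of _ "zmul m p"]) auto
qed

text \<open>If \<open>x\<close> is annihilated by the differences along \<open>p\<close> and \<open>q\<close>, then on each coset of the
  lattice spanned by \<open>p\<close> and \<open>q\<close> it is the sum of a function of the \<open>q\<close>-coordinate and one of the
  \<open>p\<close>-coordinate, \<open>x (h + i p + j q) = x (h + j q) + (x (h + i p) - x h)\<close>. Choosing one base point
  \<open>h\<close> in each coset makes both terms well defined and integer valued.\<close>

lemma two_term_decomposition:
  assumes x: "diff p (diff q x) = (\<lambda>g. 0)" and pq: "cross p q \<noteq> 0"
  shows "\<exists>y z. is_period y p \<and> is_period z q \<and> (\<forall>g. x g = y g + z g)"
proof -
  define E where "E g h \<longleftrightarrow> (\<exists>i j. g = h + zmul i p + zmul j q)" for g h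
  define \<rho> where "\<rho> g = (SOME h. E g h)" for g
  have E_refl: "E g g" for g unfolding E_def by (intro exI[of _ 0]) simp
  then have "E g (\<rho> g)" for g unfolding \<rho>_def by (rule someI)
  then obtain I J where IJ: "g = \<rho> g + zmul (I g) p + zmul (J g) q" for g
    unfolding E_def by metis
  have uniq: "i = i' \<and> j = j'"
    if "h + zmul i p + zmul j q = h + zmul i' p + zmul j' q" for h i i' j j'
  proof -
    have eq: "zmul i p + zmul j q = zmul i' p + zmul j' q" using that by (simp add: add.assoc)
    have "cross (zmul i p + zmul j q) q = cross (zmul i' p + zmul j' q) q"
      "cross p (zmul i p + zmul j q) = cross p (zmul i' p + zmul j' q)"
      unfolding eq by (rule refl)+
    then show ?thesis using pq by simp
  qed
  have E_shift: "E (g + zmul m p + zmul n q) h \<longleftrightarrow> E g h" for g h m n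
  proof
    assume "E (g + zmul m p + zmul n q) h"
    then obtain i j where "g + zmul m p + zmul n q = h + zmul i p + zmul j q"
      unfolding E_def by blast
    then have "g = h + zmul (i - m) p + zmul (j - n) q" by (simp add: zmul_diff algebra_simps)
    then show "E g h" unfolding E_def by blast
  next
    assume "E g h"
    then obtain i j where "g = h + zmul i p + zmul j q" unfolding E_def by blast
    then have "g + zmul m p + zmul n q = h + zmul (i + m) p + zmul (j + n) q"
      by (simp add: zmul_add algebra_simps)
    then show "E (g + zmul m p + zmul n q) h" unfolding E_def by blast
  qed
  have \<rho>_shift: "\<rho> (g + zmul m p + zmul n q) = \<rho> g" for g m n
    unfolding \<rho>_def E_shift ..
  have IJ_shift: "I (g + zmul m p + zmul n q) = I g + m \<and> J (g + zmul m p + zmul n q) = J g + n"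
    for g m n
  proof (rule uniq)
    show "\<rho> g + zmul (I (g + zmul m p + zmul n q)) p + zmul (J (g + zmul m p + zmul n q)) q
        = \<rho> g + zmul (I g + m) p + zmul (J g + n) q"
      using IJ[of "g + zmul m p + zmul n q"] IJ[of g] unfolding \<rho>_shift
      by (simp add: zmul_add algebra_simps)
  qed
  have p_step: "\<rho> (g + p) = \<rho> g" "I (g + p) = I g + 1" "J (g + p) = J g" for g
    using \<rho>_shift[of g 1 0] IJ_shift[of g 1 0] by auto
  have q_step: "\<rho> (g + q) = \<rho> g" "I (g + q) = I g" "J (g + q) = J g + 1" for g
    using \<rho>_shift[of g 0 1] IJ_shift[of g 0 1] by auto
  \<comment> \<open>The difference along \<open>q\<close> is \<open>p\<close>-invariant; as the two differences commute, the
    difference along \<open>i p\<close> is \<open>q\<close>-invariant.\<close>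
  have split: "x (h + zmul i p + zmul j q) = x (h + zmul j q) + (x (h + zmul i p) - x h)" for h i j
  proof -
    have "diff q x (g + p) = diff q x g" for g using fun_cong[OF x, of g] by (simp add: diff_def)
    then have "diff q x (g + zmul i p) = diff q x g" for g by (rule invariant_zmul)
    then have "diff (zmul i p) x (g + q) = diff (zmul i p) x g" for g
      by (simp add: diff_def algebra_simps)
    then have "diff (zmul i p) x (h + zmul j q) = diff (zmul i p) x h" by (rule invariant_zmul)
    then show ?thesis by (simp add: diff_def algebra_simps)
  qed
  have nz: "p \<noteq> 0" "q \<noteq> 0" using pq by auto
  let ?y = "\<lambda>g. x (\<rho> g + zmul (J g) q)" and ?z = "\<lambda>g. x (\<rho> g + zmul (I g) p) - x (\<rho> g)"
  have "is_period ?y p" "is_period ?z q"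
    using nz by (simp_all add: is_period_def p_step q_step)
  moreover have "x g = ?y g + ?z g" for g
    using split[of "\<rho> g" "I g" "J g"] IJ[of g] by simp
  ultimately show ?thesis by blast
qed

section \<open>Expansiveness transverse to the periods\<close>

text \<open>The signed distance from the line spanned by \<open>v\<close>, multiplied by the norm of \<open>v\<close>.\<close>

definition perp :: "real \<times> real \<Rightarrow> point \<Rightarrow> real" where
  "perp v g = emb g \<bullet> (- snd v, fst v)"

lemma perp_add: "perp v (g + h) = perp v g + perp v h"
  by (simp add: perp_def emb_def inner_prod_def algebra_simps)

lemma perp_minus: "perp v (- h) = - perp v h"
  by (simp add: perp_def emb_def inner_prod_def algebra_simps)

lemma half_plane_perp: "half_plane v = {g. 0 \<le> perp v g}"
  by (simp add: half_plane_def perp_def)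

lemma norm_rotate: "norm (- snd v, fst v) = norm (v :: real \<times> real)"
  by (simp add: norm_prod_def)

lemma perp_eq_0_iff:
  assumes "v \<noteq> 0" shows "perp v g = 0 \<longleftrightarrow> emb g \<in> span {v}"
proof
  assume "emb g \<in> span {v}"
  then show "perp v g = 0" by (auto simp: span_singleton perp_def inner_prod_def)
next
  assume "perp v g = 0"
  then have z: "snd (emb g) * fst v = fst (emb g) * snd v"
    by (simp add: perp_def inner_prod_def algebra_simps)
  show "emb g \<in> span {v}"
  proof (cases "fst v = 0")
    case True
    then have "snd v \<noteq> 0" using assms by (auto simp: prod_eq_iff)
    then have "emb g = (snd (emb g) / snd v) *\<^sub>R v"
      using z True by (simp add: prod_eq_iff)
    then show ?thesis by (metis span_base span_mul singletonI)
  next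
    case False
    then have "emb g = (fst (emb g) / fst v) *\<^sub>R v"
      using z by (simp add: prod_eq_iff field_simps)
    then show ?thesis by (metis span_base span_mul singletonI)
  qed
qed

lemma norm_mult_infdist_line:
  assumes v: "v \<noteq> 0" shows "norm v * infdist (emb g) (span {v}) = \<bar>perp v g\<bar>"
proof (rule antisym)
  let ?w = "(- snd v, fst v)"
  let ?p = "((emb g \<bullet> v) / (norm v)\<^sup>2) *\<^sub>R v"
  have nv: "(norm v)\<^sup>2 \<noteq> 0" "norm v > 0" using v by simp_all
  have nv2: "(norm v)\<^sup>2 = (fst v)\<^sup>2 + (snd v)\<^sup>2"
    by (simp add: norm_prod_def)
  have eq: "emb g - ?p = (perp v g / (norm v)\<^sup>2) *\<^sub>R ?w"
    using nv unfolding nv2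
    by (simp add: prod_eq_iff perp_def inner_prod_def field_simps power2_eq_square)
  have "dist (emb g) ?p = \<bar>perp v g\<bar> / (norm v)\<^sup>2 * norm v"
    unfolding dist_norm eq norm_scaleR norm_rotate by simp
  also have "\<dots> = \<bar>perp v g\<bar> / norm v" using nv by (simp add: power2_eq_square)
  finally have "infdist (emb g) (span {v}) \<le> \<bar>perp v g\<bar> / norm v"
    using infdist_le[of ?p "span {v}" "emb g"] by (simp add: span_mul span_base)
  then show "norm v * infdist (emb g) (span {v}) \<le> \<bar>perp v g\<bar>"
    using nv by (simp add: field_simps)
  have "\<bar>perp v g\<bar> / norm v \<le> dist (emb g) q" if "q \<in> span {v}" for q
  proof -
    have "q \<bullet> ?w = 0" using that by (auto simp: span_singleton inner_prod_def)
    then have "perp v g = (emb g - q) \<bullet> ?w" by (simp add: perp_def inner_diff_left)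
    then have "\<bar>perp v g\<bar> \<le> norm (emb g - q) * norm ?w" by (metis Cauchy_Schwarz_ineq2)
    then show ?thesis using nv by (simp only: norm_rotate dist_norm) (simp add: field_simps)
  qed
  then have "\<bar>perp v g\<bar> / norm v \<le> infdist (emb g) (span {v})"
    unfolding infdist_def using span_zero[of "{v}"] by (auto intro!: cINF_greatest)
  then show "\<bar>perp v g\<bar> \<le> norm v * infdist (emb g) (span {v})"
    using nv by (simp add: field_simps)
qed

lemma strip_line_iff:
  "v \<noteq> 0 \<Longrightarrow> g \<in> strip (span {v}) t \<longleftrightarrow> \<bar>perp v g\<bar> \<le> norm v * t"
  by (simp add: strip_def flip: norm_mult_infdist_line)

lemma perp_unbounded:
  assumes "v \<noteq> 0" shows "\<exists>u. perp v u \<ge> C"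
proof -
  obtain g where g: "perp v g > 0"
  proof (cases "fst v = 0")
    case True
    then have "snd v \<noteq> 0" using assms by (auto simp: prod_eq_iff)
    then have "perp v (-1, 0) > 0 \<or> perp v (1, 0) > 0"
      by (auto simp: perp_def emb_def inner_prod_def)
    then show ?thesis using that by blast
  next
    case False
    then have "perp v (0, 1) > 0 \<or> perp v (0, -1) > 0"
      by (auto simp: perp_def emb_def inner_prod_def)
    then show ?thesis using that by blast
  qed
  obtain n where n: "C \<le> real n * perp v g"
    using reals_Archimedean3[OF g, rule_format, of C] by (meson less_imp_le)
  have "perp v (zmul (int n) g) = real n * perp v g"
    by (simp add: perp_def emb_def zmul_def inner_prod_def algebra_simps)
  then show ?thesis using n by metis
qed

text \<open>Shifting by a vector far inside the half plane moves the whole strip into it.\<close>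

lemma expansive_imp_one_sided_expansive:
  assumes shift: "\<And>x u. x \<in> X \<Longrightarrow> shift u x \<in> X" and v: "v \<noteq> 0"
    and exp: "expansive X (span {v})"
  shows "one_sided_expansive X v"
  unfolding one_sided_expansive_def
proof (intro ballI impI)
  fix x y assume xy: "x \<in> X" "y \<in> X" "\<forall>g\<in>half_plane v. x g = y g"
  obtain t where t: "t > 0"
    and det: "\<forall>x\<in>X. \<forall>y\<in>X. (\<forall>g\<in>strip (span {v}) t. x g = y g) \<longrightarrow> x = y"
    using exp unfolding expansive_def by blast
  obtain u where u: "perp v u \<ge> norm v * t" using perp_unbounded[OF v] by blast
  have "shift u x g = shift u y g" if "g \<in> strip (span {v}) t" for g
  proof -
    have "0 \<le> perp v (g + u)" using that u v by (auto simp: strip_line_iff perp_add)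
    then show ?thesis using xy(3) by (simp add: shift_def half_plane_perp)
  qed
  then have "shift u x = shift u y" using det shift xy by blast
  then have "shift u x (g - u) = shift u y (g - u)" for g by simp
  then show "x = y" by (simp add: shift_def fun_eq_iff)
qed

text \<open>A recurrence of order one in direction \<open>h\<close> propagates zeros from a band of width \<open>L h\<close> to
  everything above it. It is enough that the recurrence holds on the upper side, which
  allows the lemma to be applied to several difference operators one after the other.\<close>

lemma vanish_beyond_band:
  fixes L :: "point \<Rightarrow> real" and z :: "int config"
  assumes add: "\<And>g h. L (g + h) = L g + L h" and h: "L h > 0"
    and rec: "\<And>g. 0 \<le> L g \<Longrightarrow> diff h z g = 0"
    and band: "\<And>g. 0 \<le> L g \<Longrightarrow> L g \<le> L h \<Longrightarrow> z g = 0"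
    and g: "0 \<le> L g"
  shows "z g = 0"
proof -
  have "z g = 0" if "0 \<le> L g" "L g \<le> real n * L h" for n g
    using that
  proof (induction n arbitrary: g)
    case 0
    then show ?case using band h by simp
  next
    case (Suc n)
    show ?case
    proof (cases "L g \<le> L h")
      case False
      have "L g = L (g - h) + L h" using add[of "g - h" h] by simp
      then have "0 \<le> L (g - h)" "L (g - h) \<le> real n * L h"
        using False Suc.prems by (simp_all add: algebra_simps)
      then show ?thesis using Suc.IH[of "g - h"] rec[of "g - h"] by (simp add: diff_def)
    qed (use Suc.prems band in simp)
  qed
  moreover obtain n where "L g \<le> real n * L h"
    using reals_Archimedean3[OF h, rule_format, of "L g"] by (meson less_imp_le)
  ultimately show ?thesis using g by blast
qed

text \<open>The differences are removed one at a time from the outside: the band has to be as wide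
  as the total extent of the three steps, since each difference costs its own step in width.\<close>

lemma vanish_beyond_band3:
  fixes L :: "point \<Rightarrow> real" and z :: "int config"
  assumes add: "\<And>g h. L (g + h) = L g + L h"
    and pos: "L p > 0" "L q > 0" "L r > 0"
    and rec: "diff p (diff q (diff r z)) = (\<lambda>g. 0)"
    and band: "\<And>g. 0 \<le> L g \<Longrightarrow> L g \<le> L p + L q + L r \<Longrightarrow> z g = 0"
    and g: "0 \<le> L g"
  shows "z g = 0"
proof -
  note van = vanish_beyond_band[where L = L, OF add]
  have r: "diff r z g = 0" if "0 \<le> L g" "L g \<le> L p + L q" for g
    unfolding diff_def using that pos band[of g] band[of "g + r"] add[of g r] by simp
  have q: "diff q (diff r z) g = 0" if "0 \<le> L g" "L g \<le> L p" for g
    unfolding diff_def[of q] using that pos r[of g] r[of "g + q"] add[of g q] by simp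
  have q': "diff q (diff r z) g = 0" if "0 \<le> L g" for g
    by (rule van[where h = p]) (use pos rec q that in auto)
  have r': "diff r z g = 0" if "0 \<le> L g" for g
  proof (rule van[where h = q])
    show "diff r z k = 0" if "0 \<le> L k" "L k \<le> L q" for k
      using r[of k] that pos by simp
  qed (use pos q' that in auto)
  show ?thesis
  proof (rule van[where h = r])
    show "z k = 0" if "0 \<le> L k" "L k \<le> L r" for k
      using band[of k] that pos by simp
  qed (use pos r' g in auto)
qed

text \<open>The relation involves eight coordinates at a time, so it passes to the closure.\<close>

lemma diff3_orbit_closure:
  assumes x: "x \<in> orbit_closure \<eta>" and rec: "diff p (diff q (diff r \<eta>)) = (\<lambda>g. 0)"
  shows "diff p (diff q (diff r x)) = (\<lambda>g. 0)"
proof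
  fix g
  let ?F = "{g, g + p, g + q, g + r, g + p + q, g + p + r, g + q + r, g + p + q + r}"
  have "finite ?F" by simp
  then obtain u where u: "\<forall>k\<in>?F. x k = \<eta> (k + u)"
    using x unfolding orbit_closure_iff by blast
  have "diff p (diff q (diff r x)) g = diff p (diff q (diff r \<eta>)) (g + u)"
    using u by (simp add: diff_def ac_simps)
  then show "diff p (diff q (diff r x)) g = 0" by (simp add: rec)
qed

lemma diff3_sum:
  assumes "is_period a p" "is_period b q" "is_period c r"
  shows "diff p (diff q (diff r (\<lambda>g. a g + b g + c g))) = (\<lambda>g. 0)"
proof -
  have "diff p (diff q (diff r a)) = diff q (diff r (diff p a))"
    by (simp add: diff_def fun_eq_iff ac_simps)
  then have "diff p (diff q (diff r a)) = (\<lambda>g. 0)"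
    by (simp add: is_period_diff[OF assms(1)])
  moreover have "diff p (diff q (diff r b)) = (\<lambda>g. 0)"
    unfolding diff_commute[of q r] by (simp add: is_period_diff[OF assms(2)])
  moreover have "diff p (diff q (diff r c)) = (\<lambda>g. 0)"
    by (simp add: is_period_diff[OF assms(3)])
  ultimately show ?thesis by (simp add: diff_add)
qed

lemma expansive_transverse_to_periods:
  assumes \<eta>: "\<eta> = (\<lambda>g. a g + b g + c g)"
    and per: "is_period a p" "is_period b q" "is_period c r"
    and v: "v \<noteq> 0"
    and off: "emb p \<notin> span {v}" "emb q \<notin> span {v}" "emb r \<notin> span {v}"
  shows "expansive (orbit_closure \<eta>) (span {v})"
proof -
  \<comment> \<open>Replacing a period by its negative makes all three point to the same side of the line.\<close>
  have orient: "\<exists>h'. is_period x h' \<and> perp v h' > 0"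
    if "is_period x h" "emb h \<notin> span {v}" for x :: "int config" and h
  proof (cases "perp v h > 0")
    case False
    then have "perp v (- h) > 0" using that(2) perp_eq_0_iff[OF v, of h] by (simp add: perp_minus)
    then show ?thesis using is_period_minus[OF that(1)] by blast
  qed (use that in blast)
  obtain p' where p': "is_period a p'" "perp v p' > 0" using orient per(1) off(1) by blast
  obtain q' where q': "is_period b q'" "perp v q' > 0" using orient per(2) off(2) by blast
  obtain r' where r': "is_period c r'" "perp v r' > 0" using orient per(3) off(3) by blast
  define C where "C = perp v p' + perp v q' + perp v r'"
  have "x = y" if X: "x \<in> orbit_closure \<eta>" "y \<in> orbit_closure \<eta>"
    and eq: "\<forall>g\<in>strip (span {v}) (C / norm v). x g = y g" for x y
  proof -
    let ?z = "\<lambda>g. x g - y g"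
    have rec: "diff i (diff j (diff k ?z)) = (\<lambda>g. 0)"
      if "is_period a i" "is_period b j" "is_period c k" for i j k
    proof -
      have "diff i (diff j (diff k \<eta>)) = (\<lambda>g. 0)"
        unfolding \<eta> by (rule diff3_sum) (use that in auto)
      then have "diff i (diff j (diff k x)) = (\<lambda>g. 0)" "diff i (diff j (diff k y)) = (\<lambda>g. 0)"
        using X diff3_orbit_closure by blast+
      moreover have "diff i (diff j (diff k ?z))
          = (\<lambda>g. diff i (diff j (diff k x)) g - diff i (diff j (diff k y)) g)"
        by (simp add: diff_def fun_eq_iff)
      ultimately show ?thesis by simp
    qed
    have band: "?z g = 0" if "\<bar>perp v g\<bar> \<le> C" for g
      using eq that v by (simp add: strip_line_iff)
    have "?z g = 0" for g
    proof (cases "0 \<le> perp v g")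
      case True
      have "diff p' (diff q' (diff r' ?z)) = (\<lambda>g. 0)"
        by (rule rec) (rule p' q' r')+
      then show ?thesis
        using True p'(2) q'(2) r'(2) band
        by (intro vanish_beyond_band3[of "perp v" p' q' r' ?z g]) (auto simp: perp_add C_def)
    next
      case False
      \<comment> \<open>The other side of the line is handled by reflecting the height functional and all periods.\<close>
      have "diff (- p') (diff (- q') (diff (- r') ?z)) = (\<lambda>g. 0)"
        by (rule rec) (rule is_period_minus, rule p' q' r')+
      then show ?thesis
        using False p'(2) q'(2) r'(2) band
        by (intro vanish_beyond_band3[of "\<lambda>g. - perp v g" "- p'" "- q'" "- r'" ?z g])
          (auto simp: perp_add perp_minus C_def)
    qed
    then show ?thesis by (simp add: fun_eq_iff)
  qed
  moreover have "C / norm v > 0" using p' q' r' v by (simp add: C_def)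
  ultimately show ?thesis unfolding expansive_def by blast
qed

section \<open>One-sided nonexpansiveness along a period\<close>

text \<open>The two determinants are coordinates with respect to a pair of independent vectors.\<close>

lemma finite_parallelogram:
  assumes pq: "cross p q \<noteq> 0" and fin: "finite S" "finite T"
  shows "finite {g. cross p g \<in> S \<and> cross g q \<in> T}"
proof -
  let ?f = "\<lambda>g. (cross p g, cross g q)"
  have "inj ?f"
  proof (rule injI)
    fix g h assume "?f g = ?f h"
    then have z: "cross p (g - h) = 0" "cross (g - h) q = 0" by simp_all
    have "fst (g - h) * cross p q = fst q * cross p (g - h) + fst p * cross (g - h) q"
      "snd (g - h) * cross p q = snd q * cross p (g - h) + snd p * cross (g - h) q"
      by (simp_all add: cross_def algebra_simps)
    then have "fst (g - h) = 0" "snd (g - h) = 0" using z pq by auto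
    then show "g = h" by (simp add: prod_eq_iff)
  qed
  then have "finite (?f -` (S \<times> T))" using fin by (intro finite_vimageI) auto
  moreover have "?f -` (S \<times> T) = {g. cross p g \<in> S \<and> cross g q \<in> T}" by auto
  ultimately show ?thesis by simp
qed

lemma pigeonhole_translates:
  assumes A: "finite A" "range \<eta> \<subseteq> A" and Q: "finite Q"
  shows "\<exists>k k'. k < k' \<and> k' \<le> card (Q \<rightarrow>\<^sub>E A) \<and>
           (\<forall>g\<in>Q. \<eta> (g + (u + zmul (int k) h)) = \<eta> (g + (u + zmul (int k') h)))"
proof -
  let ?K = "card (Q \<rightarrow>\<^sub>E A)"
  let ?w = "\<lambda>k. restrict (\<lambda>g. \<eta> (g + (u + zmul (int k) h))) Q"
  have "?w ` {..?K} \<subseteq> (Q \<rightarrow>\<^sub>E A)" using A(2) by (auto simp: PiE_iff)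
  moreover have "finite (Q \<rightarrow>\<^sub>E A)" using Q A(1) by (intro finite_PiE)
  ultimately have "card (?w ` {..?K}) < card {..?K}"
    using card_mono[of "Q \<rightarrow>\<^sub>E A" "?w ` {..?K}"] by simp
  then have "\<not> inj_on ?w {..?K}" by (rule pigeonhole)
  then obtain i j where ij: "i \<le> ?K" "j \<le> ?K" "?w i = ?w j" "i \<noteq> j" by (auto simp: inj_on_def)
  have eq: "\<eta> (g + (u + zmul (int i) h)) = \<eta> (g + (u + zmul (int j) h))" if "g \<in> Q" for g
    using fun_cong[OF ij(3), of g] that by simp
  show ?thesis
  proof (cases "i < j")
    case True
    then show ?thesis using ij eq by blast
  next
    case False
    then have "j < i" using ij by simp
    then show ?thesis using ij eq[symmetric] by blast
  qed
qed

text \<open>The walk downwards. Heights are measured by \<open>cross p\<close>, the vector \<open>r\<close> descends by \<open>s\<close>, and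
  \<open>R\<close> represents the lowest layer \<open>0 \<le> cross p g < s\<close> modulo \<open>p\<close>. The window \<open>Q\<close> is closed under moving
  by \<open>r\<close> as long as the height permits. If \<open>d = x - y\<close> vanishes on a translate of \<open>Q\<close> by a multiple of
  \<open>r\<close>, then the difference of \<open>d\<close> along \<open>r\<close> vanishes there as well: above the lowest layer because
  both points involved lie in the translate, and on the lowest layer because determinism yields \<open>d = 0\<close>
  at the points of \<open>R\<close> moved by \<open>r\<close>, and \<open>p\<close>-periodicity reduces every other point to these. Hence
  \<open>d\<close> vanishes on the translate of \<open>Q\<close> by one more \<open>r\<close>.\<close>

lemma difference_vanishes_below:
  fixes x y :: "int config"
  assumes shift: "\<And>x u. x \<in> X \<Longrightarrow> shift u x \<in> X"
    and s: "s > 0" "cross p r = - s"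
    and det: "\<And>x y. x \<in> X \<Longrightarrow> y \<in> X \<Longrightarrow> \<forall>g\<in>F. x g = y g \<Longrightarrow> \<forall>g\<in>R. x (g + r) = y (g + r)"
    and reps: "\<And>g. 0 \<le> cross p g \<Longrightarrow> cross p g < s \<Longrightarrow> \<exists>k. g + zmul k p \<in> R"
    and FQ: "F \<subseteq> Q" and RQ: "R \<subseteq> Q"
    and Q: "\<And>g. g \<in> Q \<Longrightarrow> 0 \<le> cross p g" "\<And>g. g \<in> Q \<Longrightarrow> s \<le> cross p g \<Longrightarrow> g + r \<in> Q"
    and xy: "x \<in> X" "y \<in> X" "\<forall>g\<in>Q. x g = y g"
    and per: "\<And>g. diff r (\<lambda>g. x g - y g) (g + p) = diff r (\<lambda>g. x g - y g) g"
    and g: "cross p g < s"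
  shows "diff r (\<lambda>g. x g - y g) g = 0"
proof -
  define d where "d = (\<lambda>g. x g - y g)"
  have per': "diff r d (g + zmul k p) = diff r d g" for g k
    by (rule invariant_zmul) (use per in \<open>simp add: d_def\<close>)
  have zero: "\<forall>g\<in>Q. d (g + zmul (int n) r) = 0" for n
  proof (induction n)
    case 0
    then show ?case using xy(3) by (simp add: d_def)
  next
    case (Suc n)
    let ?u = "zmul (int n) r"
    have "\<forall>g\<in>F. shift ?u x g = shift ?u y g" using Suc FQ by (auto simp: shift_def d_def)
    then have "\<forall>g\<in>R. shift ?u x (g + r) = shift ?u y (g + r)" using det shift xy by blast
    then have below: "d (g + r + ?u) = 0" if "g \<in> R" for g
      using that by (simp add: shift_def d_def)
    have flat: "diff r d (g + ?u) = 0" if "g \<in> R" for g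
      using below[OF that] Suc that RQ by (auto simp: diff_def ac_simps)
    have "diff r d (g + ?u) = 0" if g: "g \<in> Q" for g
    proof (cases "s \<le> cross p g")
      case True
      then show ?thesis using Suc g Q(2)[OF g True] by (auto simp: diff_def ac_simps)
    next
      case False
      then obtain k where "g + zmul k p \<in> R" using reps[of g] Q(1)[OF g] by force
      then have "diff r d (g + zmul k p + ?u) = 0" by (rule flat)
      then have "diff r d (g + ?u + zmul k p) = 0" by (simp add: ac_simps)
      then show ?thesis by (simp add: per')
    qed
    then have "d (g + ?u + r) = 0" if "g \<in> Q" for g using that Suc by (simp add: diff_def)
    then show ?case by (simp add: zmul_add ac_simps)
  qed
  \<comment> \<open>The number of steps along \<open>r\<close> after which the lowest layer of the window reaches the height of \<open>g\<close>.\<close>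
  define n where "n = nat (- (cross p g div s))"
  have "cross p g div s \<le> (s - 1) div s" using g s(1) by (intro zdiv_mono1) auto
  also have "\<dots> = 0" using s(1) by (intro div_pos_pos_trivial) auto
  finally have "cross p g div s \<le> 0" .
  then have n: "int n = - (cross p g div s)" by (simp add: n_def)
  let ?h = "g - zmul (int n) r"
  have "cross p ?h = cross p g mod s"
    by (simp add: n s(2) minus_div_mult_eq_mod[symmetric])
  then have "0 \<le> cross p ?h" "cross p ?h < s" using s(1) by simp_all
  then obtain k where "?h + zmul k p \<in> R" using reps by blast
  then have "?h + zmul k p \<in> Q" using RQ by blast
  then have "d (?h + zmul k p + zmul (int n) r) = 0" "d (?h + zmul k p + zmul (int (Suc n)) r) = 0"
    using zero by blast+
  then have "d (g + zmul k p) = 0" "d (g + zmul k p + r) = 0"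
    by (simp_all add: zmul_add algebra_simps)
  then have "diff r d (g + zmul k p) = 0" by (simp add: diff_def)
  then have "diff r d g = 0" by (simp add: per')
  then show ?thesis by (simp add: d_def)
qed

text \<open>One-sided determinism along \<open>p\<close> forces recurrence in direction \<open>q\<close> on arbitrarily high lower half
  planes. The bound \<open>K\<close> is the number of patterns on the window, which does not depend on the
  height \<open>M\<close>, and this uniformity is what the next lemma exploits.\<close>

lemma one_sided_expansive_local_recurrence:
  assumes A: "finite A" "range \<eta> \<subseteq> A"
    and \<eta>: "\<eta> = (\<lambda>g. a g + b g + c g)"
    and per: "is_period a p" "is_period b q" "is_period c r"
    and neg: "cross p r < 0"
    and half: "half_plane v = {g. 0 \<le> cross p g}"
    and exp: "one_sided_expansive (orbit_closure \<eta>) v"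
  shows "\<exists>K. \<forall>M. \<exists>k\<in>{1..K}. \<forall>g. cross p g \<le> M \<longrightarrow>
           diff r \<eta> (g + zmul (int k) q) = diff r \<eta> g"
proof -
  define s where "s = - cross p r"
  have s: "s > 0" "cross p r = - s" using neg by (simp_all add: s_def)
  define R where "R = {g. cross p g \<in> {0..<s} \<and> cross g r \<in> {0..<s}}"
  have finR: "finite R" unfolding R_def by (rule finite_parallelogram) (use neg in auto)
  have reps: "\<exists>k. g + zmul k p \<in> R" if "0 \<le> cross p g" "cross p g < s" for g
  proof (intro exI)
    have "cross g r + (cross g r div s) * cross p r = cross g r mod s"
      by (simp add: s(2) minus_div_mult_eq_mod[symmetric])
    then show "g + zmul (cross g r div s) p \<in> R"
      using that s(1) by (simp add: R_def)
  qed
  from one_sided_expansive_finite_window[OF compact_orbit_closure[OF A] exp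
      finite_imageI[OF finR, of "\<lambda>g. g + r"]]
  obtain F where F: "finite F" "F \<subseteq> half_plane v"
    and detF: "\<forall>x\<in>orbit_closure \<eta>. \<forall>y\<in>orbit_closure \<eta>. (\<forall>g\<in>F. x g = y g) \<longrightarrow>
                 (\<forall>g\<in>(\<lambda>g. g + r) ` R. x g = y g)"
    by (elim exE conjE)
  \<comment> \<open>Restricting the height and \<open>cross g r\<close> separately gives a finite window closed under
    descending by \<open>r\<close>, because \<open>cross g r\<close> does not change along \<open>r\<close>.\<close>
  define Q where "Q = {g. cross p g \<in> {0..Max (insert 0 (cross p ` (F \<union> R)))} \<and>
                         cross g r \<in> (\<lambda>g. cross g r) ` (F \<union> R)}"
  have finQ: "finite Q"
    unfolding Q_def by (rule finite_parallelogram) (use neg F finR in auto)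
  have sub: "F \<union> R \<subseteq> Q"
  proof
    fix g assume g: "g \<in> F \<union> R"
    then have "0 \<le> cross p g" using F(2) half by (auto simp: R_def)
    moreover have "cross p g \<le> Max (insert 0 (cross p ` (F \<union> R)))"
      using g F finR by (intro Max_ge) auto
    ultimately show "g \<in> Q" using g by (simp add: Q_def)
  qed
  have Q1: "0 \<le> cross p g" if "g \<in> Q" for g using that by (simp add: Q_def)
  have Q2: "g + r \<in> Q" if "g \<in> Q" "s \<le> cross p g" for g using that s by (simp add: Q_def)
  define K where "K = card (Q \<rightarrow>\<^sub>E A)"
  have "\<exists>k\<in>{1..K}. \<forall>g. cross p g \<le> M \<longrightarrow> diff r \<eta> (g + zmul (int k) q) = diff r \<eta> g" for M
  proof -
    \<comment> \<open>High enough that each of the translates of the window by \<open>k q\<close> with \<open>k \<le> K\<close> lies above \<open>M\<close>.\<close>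
    define N where "N = \<bar>M\<bar> + int K * \<bar>cross p q\<bar>"
    define u where "u = zmul (- N) r"
    have u: "cross p u \<ge> N"
    proof -
      have "N * 1 \<le> N * s" using s(1) by (intro mult_left_mono) (auto simp: N_def)
      then show ?thesis by (simp add: u_def s(2))
    qed
    obtain k k' where k: "k < k'" "k' \<le> K"
      and agree: "\<forall>g\<in>Q. \<eta> (g + (u + zmul (int k) q)) = \<eta> (g + (u + zmul (int k') q))"
      using pigeonhole_translates[OF A finQ, of u q] unfolding K_def by blast
    let ?x = "shift (u + zmul (int k') q) \<eta>" and ?y = "shift (u + zmul (int k) q) \<eta>"
    have bq: "b (g + zmul n q) = b g" for g n
      by (rule invariant_zmul) (use per(2) in \<open>simp add: is_period_def\<close>)
    have cr: "c (g + r) = c g" and ap: "a (g + p) = a g" for g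
      using per by (simp_all add: is_period_def)
    have ap': "a (g + p + h) = a (g + h)" for g h using ap[of "g + h"] by (simp add: ac_simps)
    have cr': "c (g + r + h) = c (g + h)" for g h using cr[of "g + h"] by (simp add: ac_simps)
    have bq': "b (g + (h + zmul n q)) = b (g + h)" for g h n
      using bq[of "g + h"] by (simp add: ac_simps)
    \<comment> \<open>The term \<open>b\<close> cancels between the two translates, and the term \<open>c\<close> in the difference along \<open>r\<close>.\<close>
    have e: "diff r (\<lambda>g. ?x g - ?y g) g
        = a (g + r + (u + zmul (int k') q)) - a (g + r + (u + zmul (int k) q))
          - (a (g + (u + zmul (int k') q)) - a (g + (u + zmul (int k) q)))" for g
      by (simp add: diff_def shift_def \<eta> cr' bq')
    have ap'': "a (g + p + r + h) = a (g + r + h)" for g h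
      using ap[of "g + r + h"] by (simp add: ac_simps)
    have e_per: "diff r (\<lambda>g. ?x g - ?y g) (g + p) = diff r (\<lambda>g. ?x g - ?y g) g" for g
      unfolding e ap' ap'' by (rule refl)
    have van: "diff r (\<lambda>g. ?x g - ?y g) g = 0" if g: "cross p g < s" for g
    proof (rule difference_vanishes_below[where X = "orbit_closure \<eta>" and F = F and R = R
          and Q = Q and s = s and p = p and x = ?x and y = ?y and g = g])
      show "\<forall>g\<in>R. x (g + r) = y (g + r)"
        if "x \<in> orbit_closure \<eta>" "y \<in> orbit_closure \<eta>" "\<forall>g\<in>F. x g = y g" for x y
        using detF[rule_format, OF that(1,2)] that(3) by simp
      show "\<forall>g\<in>Q. ?x g = ?y g" using agree by (simp add: shift_def)
      show "F \<subseteq> Q" "R \<subseteq> Q" using sub by auto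
    qed (fact orbit_closure_shift s reps Q1 Q2 shift_in_orbit_closure e_per g)+
    have "diff r \<eta> (g + zmul (int (k' - k)) q) = diff r \<eta> g" if "cross p g \<le> M" for g
    proof -
      let ?g = "g - (u + zmul (int k) q)"
      have "\<bar>int k * cross p q\<bar> \<le> int K * \<bar>cross p q\<bar>"
        unfolding abs_mult using k by (intro mult_right_mono) auto
      then have "cross p ?g < s" using u that s(1) unfolding N_def by simp
      then have "diff r (\<lambda>g. ?x g - ?y g) ?g = 0" by (rule van)
      moreover have "int (k' - k) = int k' - int k" using k by simp
      ultimately show ?thesis by (simp add: diff_def shift_def zmul_diff algebra_simps)
    qed
    moreover have "k' - k \<in> {1..K}" using k by auto
    ultimately show ?thesis by blast
  qed
  then show ?thesis by blast
qed

text \<open>Every \<open>k \<in> {1..K}\<close> divides \<open>K!\<close>; whichever \<open>k\<close> occurs on a half plane that is high enough for the given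
  point, repeating the step reaches \<open>K! q\<close>.\<close>

lemma bounded_recurrence_imp_periodic:
  assumes "\<And>M. \<exists>k\<in>{1..K}. \<forall>g. cross p g \<le> M \<longrightarrow> w (g + zmul (int k) q) = w g"
  shows "w (g + zmul (int (fact K)) q) = w g"
proof -
  \<comment> \<open>No intermediate point of the chain from \<open>g\<close> to \<open>g + K! q\<close> lies higher than this.\<close>
  define M where "M = cross p g + int (fact K) * \<bar>cross p q\<bar>"
  obtain k where k: "k \<in> {1..K}"
    and step: "\<And>g. cross p g \<le> M \<Longrightarrow> w (g + zmul (int k) q) = w g"
    using assms by blast
  obtain t where t: "fact K = t * k" using k dvd_fact[of k K] by (auto simp: dvd_def mult.commute)
  have "w (g + zmul (int (i * k)) q) = w g" if "i \<le> t" for i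
    using that
  proof (induction i)
    case (Suc i)
    have "i * k \<le> fact K" using Suc.prems by (simp add: t)
    then have "int (i * k) * \<bar>cross p q\<bar> \<le> int (fact K) * \<bar>cross p q\<bar>"
      by (intro mult_right_mono) (simp_all only: of_nat_le_iff abs_ge_zero)
    moreover have "int (i * k) * cross p q \<le> int (i * k) * \<bar>cross p q\<bar>"
      by (intro mult_left_mono) simp_all
    ultimately have "cross p (g + zmul (int (i * k)) q) \<le> M" unfolding M_def by simp
    then have "w (g + zmul (int (i * k)) q + zmul (int k) q) = w g"
      using step Suc by simp
    moreover have "zmul (int (Suc i * k)) q = zmul (int (i * k)) q + zmul (int k) q"
      by (simp add: algebra_simps flip: zmul_add)
    ultimately show ?case by (simp add: add.assoc)
  qed simp
  then show ?thesis using t by simp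
qed

lemma nonexpansive_along_period:
  assumes A: "finite A" "range \<eta> \<subseteq> A"
    and \<eta>: "\<eta> = (\<lambda>g. a g + b g + c g)"
    and per: "is_period a p" "is_period b q" "is_period c r"
    and indep: "cross p r \<noteq> 0" "cross q r \<noteq> 0"
    and two: "\<not> (\<exists>y z. periodic y \<and> periodic z \<and> (\<forall>g. \<eta> g = y g + z g))"
    and half: "half_plane v = {g. 0 \<le> cross p g}"
  shows "\<not> one_sided_expansive (orbit_closure \<eta>) v"
proof
  assume exp: "one_sided_expansive (orbit_closure \<eta>) v"
  obtain r' where r': "is_period c r'" "cross p r' < 0" "cross q r' \<noteq> 0"
  proof (cases "cross p r < 0")
    case False
    then show ?thesis using that[of "- r"] is_period_minus[OF per(3)] indep by simp
  qed (use that per indep in blast)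
  obtain K where "\<forall>M. \<exists>k\<in>{1..K}. \<forall>g. cross p g \<le> M \<longrightarrow>
      diff r' \<eta> (g + zmul (int k) q) = diff r' \<eta> g"
    using one_sided_expansive_local_recurrence[OF A \<eta> per(1,2) r'(1,2) half exp] by blast
  then have "diff r' \<eta> (g + zmul (int (fact K)) q) = diff r' \<eta> g" for g
    by (intro bounded_recurrence_imp_periodic) blast
  then have "diff (zmul (int (fact K)) q) (diff r' \<eta>) = (\<lambda>g. 0)"
    by (simp add: diff_def[of "zmul (int (fact K)) q"] del: of_nat_fact)
  moreover have "cross (zmul (int (fact K)) q) r' \<noteq> 0" using r'(3) by simp
  ultimately show False
    using two_term_decomposition[of "zmul (int (fact K)) q" r' \<eta>] two unfolding periodic_def by blast
qed

section \<open>Minimal decompositions with three terms\<close>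

lemma half_plane_emb: "half_plane (emb p) = {g. 0 \<le> cross p g}"
proof -
  have "emb g \<bullet> (- snd (emb p), fst (emb p)) = real_of_int (cross p g)" for g
    by (simp add: emb_def inner_prod_def cross_def)
  then show ?thesis by (simp add: half_plane_def)
qed

text \<open>Both a period and its negative are periods, and one of the two has the orientation of \<open>u\<close>.\<close>

lemma half_plane_parallel:
  assumes p: "is_period a p" and l: "l \<in> lines_through_origin" "emb p \<in> l" "u \<in> l - {0}"
  obtains p' where "is_period a p'" "half_plane u = {g. 0 \<le> cross p' g}"
proof -
  have "emb p \<noteq> 0" using p by (auto simp: is_period_def emb_def prod_eq_iff)
  obtain v where v: "l = span {v}" using l(1) by (auto simp: lines_through_origin_def)
  obtain k k' where k: "emb p = k *\<^sub>R v" "u = k' *\<^sub>R v"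
    using l(2,3) by (auto simp: v span_singleton)
  have "k \<noteq> 0" "k' \<noteq> 0" using k l(3) \<open>emb p \<noteq> 0\<close> by auto
  then have u: "u = (k' / k) *\<^sub>R emb p" by (simp add: k)
  show ?thesis
  proof (cases "k' / k > 0")
    case True
    then have "half_plane u = half_plane (emb p)" unfolding u by (rule half_plane_scaleR)
    then show ?thesis using that[of p] p by (simp add: half_plane_emb)
  next
    case False
    then have "- (k' / k) > 0" using \<open>k \<noteq> 0\<close> \<open>k' \<noteq> 0\<close> by (auto simp: not_less le_less)
    moreover have "u = (- (k' / k)) *\<^sub>R emb (- p)" by (simp add: u emb_def prod_eq_iff)
    ultimately have "half_plane u = half_plane (emb (- p))" by (metis half_plane_scaleR)
    then show ?thesis using that[of "- p"] is_period_minus[OF p] by (simp add: half_plane_emb)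
  qed
qed

lemma Z_minimal_decomposition_unique_length:
  assumes "Z_minimal_decomposition \<eta> m f" "Z_minimal_decomposition \<eta> n f'"
  shows "m = n"
  using assms unfolding Z_minimal_decomposition_def by (blast intro: le_antisym)

lemma Z_minimal_decomposition3D:
  assumes min: "Z_minimal_decomposition \<eta> 3 f"
  shows no_two_terms: "\<not> (\<exists>y z. periodic y \<and> periodic z \<and> (\<forall>g. \<eta> g = y g + z g))"
    and three_terms: "\<eta> = (\<lambda>g. f 1 g + f 2 g + f 3 g)"
proof -
  have dec: "Z_periodic_decomposition \<eta> 3 f"
    and le: "Z_periodic_decomposition \<eta> n f' \<Longrightarrow> 3 \<le> n" for n f'
    using min unfolding Z_minimal_decomposition_def by blast+
  show "\<not> (\<exists>y z. periodic y \<and> periodic z \<and> (\<forall>g. \<eta> g = y g + z g))"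
  proof
    assume "\<exists>y z. periodic y \<and> periodic z \<and> (\<forall>g. \<eta> g = y g + z g)"
    then obtain y z where "periodic y" "periodic z" "\<forall>g. \<eta> g = y g + z g" by blast
    then have "Z_periodic_decomposition \<eta> 2 (\<lambda>i. if i = 1 then y else z)"
      by (simp add: Z_periodic_decomposition_def numeral_2_eq_2)
    then show False using le by force
  qed
  show "\<eta> = (\<lambda>g. f 1 g + f 2 g + f 3 g)"
    using dec by (simp add: Z_periodic_decomposition_def numeral_3_eq_3 numeral_2_eq_2 fun_eq_iff)
qed

text \<open>Terms with parallel periods have a common period and could be merged into one.\<close>

lemma minimal_periods_not_parallel:
  fixes \<eta> :: "int config"
  assumes two: "\<not> (\<exists>y z. periodic y \<and> periodic z \<and> (\<forall>g. \<eta> g = y g + z g))"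
    and \<eta>: "\<eta> = (\<lambda>g. a g + b g + c g)"
    and per: "is_period a p" "is_period b q" "periodic c"
  shows "cross p q \<noteq> 0"
proof
  assume "cross p q = 0"
  then have "periodic (\<lambda>g. a g + b g)" using per(1,2) parallel_periods_sum by simp
  then show False using two per(3) \<eta> by auto
qed

text \<open>Each of the three terms can take the role of \<open>a\<close>, and either sign of its period fixes one of the two
  orientations of the line.\<close>

lemma one_sided_nonexpansive_period_line:
  assumes A: "finite A" "range \<eta> \<subseteq> A"
    and min: "Z_minimal_decomposition \<eta> 3 f"
    and i: "i \<in> {1..3}" "is_period (f i) h"
    and l: "l \<in> lines_through_origin" "emb h \<in> l" "u \<in> l - {0}"
  shows "\<not> one_sided_expansive (orbit_closure \<eta>) u"
proof -
  note two = no_two_terms[OF min]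
  have key: "\<not> one_sided_expansive (orbit_closure \<eta>) u"
    if \<eta>: "\<eta> = (\<lambda>g. f i g + b g + c g)" and bc: "periodic b" "periodic c" for b c
  proof -
    obtain p where p: "is_period (f i) p" "half_plane u = {g. 0 \<le> cross p g}"
      using half_plane_parallel[OF i(2) l] by metis
    obtain q r where q: "is_period b q" and r: "is_period c r"
      using bc unfolding periodic_def by blast
    have fi: "periodic (f i)" using i(2) unfolding periodic_def by blast
    have "cross p r \<noteq> 0"
      using minimal_periods_not_parallel[OF two, of "f i" c b] p(1) r bc \<eta>
      by (simp add: algebra_simps)
    moreover have "cross q r \<noteq> 0"
      using minimal_periods_not_parallel[OF two, of b c "f i"] q r fi \<eta>
      by (simp add: algebra_simps)
    ultimately show ?thesis
      using nonexpansive_along_period[OF A \<eta> p(1) q r _ _ two p(2)] by blast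
  qed
  have per: "periodic (f j)" if "j \<in> {1..3}" for j
    using min that unfolding Z_minimal_decomposition_def Z_periodic_decomposition_def by blast
  note three = three_terms[OF min]
  consider "i = 1" | "i = 2" | "i = 3" using i(1) by (auto simp: le_Suc_eq numeral_3_eq_3)
  then show ?thesis
  proof cases
    case 1
    then show ?thesis using key[of "f 2" "f 3"] three per by simp
  next
    case 2
    then show ?thesis using key[of "f 1" "f 3"] three per by (simp add: algebra_simps)
  next
    case 3
    then show ?thesis using key[of "f 1" "f 2"] three per by (simp add: algebra_simps)
  qed
qed

lemma nonexpansive_line_has_period:
  assumes min: "Z_minimal_decomposition \<eta> 3 f" and l: "l \<in> NEL \<eta>"
  shows "\<exists>i\<in>{1..3}. \<exists>h. is_period (f i) h \<and> emb h \<in> l"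
proof (rule ccontr)
  assume none: "\<not> ?thesis"
  obtain v where v: "l = span {v}" "v \<noteq> 0"
    using l by (auto simp: NEL_def lines_through_origin_def)
  have per: "\<exists>h. is_period (f j) h" if "j \<in> {1..3}" for j
    using min that unfolding Z_minimal_decomposition_def Z_periodic_decomposition_def periodic_def
    by blast
  obtain p q r where pqr: "is_period (f 1) p" "is_period (f 2) q" "is_period (f 3) r"
    using per[of 1] per[of 2] per[of 3] by auto
  have off: "emb h \<notin> span {v}" if "j \<in> {1..3}" "is_period (f j) h" for j h
    using none that unfolding v(1) by blast
  have "expansive (orbit_closure \<eta>) l"
    unfolding v(1)
    by (rule expansive_transverse_to_periods[OF three_terms[OF min] pqr v(2)
          off[OF _ pqr(1)] off[OF _ pqr(2)] off[OF _ pqr(3)]]) simp_all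
  then show False using l by (simp add: NEL_def)
qed

theorem corollary4p16:
  fixes A :: "int set" and \<eta> :: "int config" and \<eta>' :: "nat \<Rightarrow> int config"
  assumes "finite A" and "card A \<ge> 2"
    and "range \<eta> \<subseteq> A"
    and "low_convex_complexity \<eta>"
    and "Z_minimal_decomposition \<eta> 3 \<eta>'"
  shows "(\<not> fully_periodic \<eta> \<longrightarrow>
            (\<forall>m \<theta>. Z_minimal_decomposition \<eta> m \<theta> \<longrightarrow>
              (\<forall>l \<in> lines_through_origin.
                (\<exists>i\<in>{1..m}. \<exists>h. is_period (\<theta> i) h \<and> emb h \<in> l) \<longleftrightarrow> l \<in> NEL \<eta>)))
       \<and> (\<forall>l \<in> lines_through_origin. \<forall>u \<in> l - {0}.
            l \<in> NEL \<eta> \<longleftrightarrow> oriented_line u \<in> ONED \<eta> \<and> oriented_line (- u) \<in> ONED \<eta>)"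
proof (intro conjI impI allI ballI)
  have nonexp: "l \<in> NEL \<eta>"
    if l: "l \<in> lines_through_origin" and u: "u \<in> l - {0}"
      and "\<not> one_sided_expansive (orbit_closure \<eta>) u" for l u
  proof -
    obtain v where "l = span {v}" using l by (auto simp: lines_through_origin_def)
    then obtain k where "u = k *\<^sub>R v" "k \<noteq> 0" using u by (auto simp: span_singleton)
    then have "l = span {u}" using \<open>l = span {v}\<close> by (simp add: span_image_scale[of "{v}" "\<lambda>_. k", simplified])
    then show ?thesis
      using expansive_imp_one_sided_expansive[of "orbit_closure \<eta>" u] orbit_closure_shift that
      by (auto simp: NEL_def)
  qed
  note one_sided = one_sided_nonexpansive_period_line[OF assms(1,3)]
  {
    fix m \<theta> l
    assume \<theta>: "Z_minimal_decomposition \<eta> m \<theta>" and l: "l \<in> lines_through_origin"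
    have m: "m = 3" using Z_minimal_decomposition_unique_length[OF \<theta> assms(5)] .
    show "(\<exists>i\<in>{1..m}. \<exists>h. is_period (\<theta> i) h \<and> emb h \<in> l) \<longleftrightarrow> l \<in> NEL \<eta>"
    proof
      assume "\<exists>i\<in>{1..m}. \<exists>h. is_period (\<theta> i) h \<and> emb h \<in> l"
      then obtain i h where i: "i \<in> {1..3}" "is_period (\<theta> i) h" "emb h \<in> l" unfolding m by blast
      have "emb h \<in> l - {0}" using i(2,3) by (auto simp: is_period_def emb_def prod_eq_iff)
      then show "l \<in> NEL \<eta>" using nonexp[OF l] one_sided[OF \<theta>[unfolded m] i(1,2) l i(3)] by blast
    next
      assume "l \<in> NEL \<eta>"
      then show "\<exists>i\<in>{1..m}. \<exists>h. is_period (\<theta> i) h \<and> emb h \<in> l"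
        unfolding m by (rule nonexpansive_line_has_period[OF \<theta>[unfolded m]])
    qed
  }
  fix l u assume l: "l \<in> lines_through_origin" and u: "u \<in> l - {0 :: real \<times> real}"
  have mu: "- u \<in> l - {0}" using l u by (auto simp: lines_through_origin_def span_neg)
  have "l \<in> NEL \<eta> \<longleftrightarrow> \<not> one_sided_expansive (orbit_closure \<eta>) u \<and>
      \<not> one_sided_expansive (orbit_closure \<eta>) (- u)"
  proof
    assume "l \<in> NEL \<eta>"
    then obtain i h where "i \<in> {1..3}" "is_period (\<eta>' i) h" "emb h \<in> l"
      using nonexpansive_line_has_period[OF assms(5)] by blast
    then show "\<not> one_sided_expansive (orbit_closure \<eta>) u \<and>
      \<not> one_sided_expansive (orbit_closure \<eta>) (- u)"
      using one_sided[OF assms(5)] l u mu by blast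
  qed (use nonexp l u in blast)
  then show "l \<in> NEL \<eta> \<longleftrightarrow> oriented_line u \<in> ONED \<eta> \<and> oriented_line (- u) \<in> ONED \<eta>"
    using u by (simp add: oriented_line_in_ONED_iff)
qed

end
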